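(* Let $n,m$ be positive integers with $m\mid n$, $b=n/m$, let $A\in\mathbb{R}^{n\times n}$ be symmetric positive semidefinite, $G\in\mathbb{R}^{n\times m}$, and $\eta\in\mathbb{R}$. Consider the problems $$(P_0)\quad \min_{X\in\mathcal{F}_1}\ \tfrac12\langle A,XX^\top\rangle+\langle G,X\rangle,\qquad (P_\eta)\quad \min_{X\in\mathcal{F}_2}\ \tfrac12\langle A,XX^\top\rangle+\langle G,X\rangle+\eta\sum_{i=1}^n\sum_{j=1}^m|X_{ij}|^{1/2},$$ where $$\mathcal{F}_1=\{X\in\mathbb{R}^{n\times m}\mid \mathbf 1_n^\top X=b\,\mathbf 1_m^\top,\ X\mathbf 1_m=\mathbf 1_n,\ X_{ij}\in\{0,1\}\},$$ $$\mathcal{F}_2=\{X\in\mathbb{R}^{n\times m}\mid \mathbf 1_n^\top X=b\,\mathbf 1_m^\top,\ X\mathbf 1_m=\mathbf 1_n,\ 0\le X_{ij}\le 1\}.$$ If $\eta>4\|A\|_\infty$, then: 1. Any local minimizer of $(P_\eta)$ is feasible and locally optimal for $(P_0)$; conversely, each feasible point of $(P_0)$ is a local minimizer of $(P_\eta)$. 2. $(P_0)$ and $(P_\eta)$ have identical sets of globally optimal solutions.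
   Context: $\mathbf 1_k\in\mathbb{R}^k$ is the all-ones vector and $\langle\cdot,\cdot\rangle$ is the Frobenius (trace) inner product. $\|A\|_\infty$ is the matrix norm induced by the vector $\infty$-norm, i.e. $\max_i\sum_j|A_{ij}|$. A point $X$ of a feasible set $S\subset\mathbb{R}^{n\times m}$ is a local minimizer (locally optimal) if it minimizes the objective over $S\cap U$ for some neighbourhood $U$ of $X$ in $\mathbb{R}^{n\times m}$. *)

theory Defs
  imports "HOL-Analysis.Analysis"
begin

text \<open>
  An \<open>n \<times> m\<close> real matrix is an element of \<open>real^'m^'n\<close>. On this type \<open>\<bullet>\<close> is the Frobenius
  inner product, the topology is the Euclidean one, and \<open>1 :: real^'k\<close> is the all-ones vector.
\<close>

definition symmetric_psd :: "real^'n^'n \<Rightarrow> bool" where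
  "symmetric_psd A \<longleftrightarrow> transpose A = A \<and> (\<forall>x. 0 \<le> x \<bullet> (A *v x))"

definition matrix_infnorm :: "real^'n^'n \<Rightarrow> real" where
  "matrix_infnorm A = (SUP x\<in>{x. x \<noteq> 0}. infnorm (A *v x) / infnorm x)"

lemma infnorm_cart_Max: "infnorm (x :: real^'n) = Max (range (\<lambda>i. \<bar>x $ i\<bar>))"
proof -
  have "{\<bar>x $ i\<bar> |i. i \<in> UNIV} = range (\<lambda>i. \<bar>x $ i\<bar>)"
    by auto
  then show ?thesis
    unfolding infnorm_cart by (simp add: cSup_eq_Max)
qed

lemma infnorm_cart_le: "infnorm (x :: real^'n) \<le> c \<longleftrightarrow> (\<forall>i. \<bar>x $ i\<bar> \<le> c)"
  unfolding infnorm_cart_Max by (subst Max_le_iff) auto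

lemma matrix_infnorm_eq_Max_row_sum:
  "matrix_infnorm (A :: real^'n^'n) = Max (range (\<lambda>i. \<Sum>j\<in>UNIV. \<bar>A $ i $ j\<bar>))" (is "_ = ?M")
proof -
  have row: "(\<Sum>j\<in>UNIV. \<bar>A $ i $ j\<bar>) \<le> ?M" for i
    by (rule Max_ge) auto
  have le: "infnorm (A *v x) / infnorm x \<le> ?M" if "x \<noteq> 0" for x :: "real^'n"
  proof -
    have pos: "infnorm x > 0"
      using that by (simp add: infnorm_pos_lt)
    have "\<bar>(A *v x) $ i\<bar> \<le> ?M * infnorm x" for i
    proof -
      have "\<bar>(A *v x) $ i\<bar> \<le> (\<Sum>j\<in>UNIV. \<bar>A $ i $ j\<bar> * \<bar>x $ j\<bar>)"
        using sum_abs[of "\<lambda>j. A $ i $ j * x $ j" UNIV]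
        by (simp add: matrix_vector_mult_def abs_mult)
      also have "\<dots> \<le> (\<Sum>j\<in>UNIV. \<bar>A $ i $ j\<bar> * infnorm x)"
        by (intro sum_mono mult_left_mono component_le_infnorm_cart) auto
      also have "\<dots> \<le> ?M * infnorm x"
        using row[of i] pos by (simp flip: sum_distrib_right)
      finally show ?thesis .
    qed
    then show ?thesis
      using pos by (simp add: infnorm_cart_le pos_divide_le_eq)
  qed
  have "?M \<in> range (\<lambda>i. \<Sum>j\<in>UNIV. \<bar>A $ i $ j\<bar>)"
    by (rule Max_in) auto
  then obtain k where k: "?M = (\<Sum>j\<in>UNIV. \<bar>A $ k $ j\<bar>)"
    by blast
  define s :: "real^'n" where "s = (\<chi> j. if A $ k $ j < 0 then -1 else 1)"
  have s_abs: "\<bar>s $ j\<bar> = 1" for j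
    by (simp add: s_def)
  have s0: "s \<noteq> 0"
    using s_abs by (metis abs_zero zero_index zero_neq_one)
  have s1: "infnorm s = 1"
    unfolding infnorm_cart_Max by (simp add: s_abs)
  have "?M = (A *v s) $ k"
    unfolding k matrix_vector_mult_def s_def by (simp, intro sum.cong) auto
  also have "\<dots> \<le> infnorm (A *v s) / infnorm s"
    using component_le_infnorm_cart[of "A *v s" k] by (simp add: s1)
  finally have ge: "?M \<le> infnorm (A *v s) / infnorm s" .
  have eq: "?M = infnorm (A *v s) / infnorm s"
    by (rule antisym[OF ge le[OF s0]])
  show ?thesis
    unfolding matrix_infnorm_def
  proof (rule cSup_eq_maximum)
    show "?M \<in> (\<lambda>x. infnorm (A *v x) / infnorm x) ` {x. x \<noteq> 0}"
      unfolding eq using s0 by (intro imageI) simp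
  next
    fix z assume "z \<in> (\<lambda>x. infnorm (A *v x) / infnorm x) ` {x. x \<noteq> 0}"
    then obtain x where "x \<noteq> 0" "z = infnorm (A *v x) / infnorm x"
      by blast
    then show "z \<le> ?M"
      using le[of x] by simp
  qed
qed

definition balanced_stochastic :: "(real^'m^'n) set" where
  "balanced_stochastic =
     {X. 1 v* X = (real CARD('n) / real CARD('m)) *\<^sub>R 1 \<and> X *v 1 = 1}"

definition feasible_binary :: "(real^'m^'n) set" where
  "feasible_binary = {X \<in> balanced_stochastic. \<forall>i j. X $ i $ j \<in> {0, 1}}"

definition feasible_relaxed :: "(real^'m^'n) set" where
  "feasible_relaxed = {X \<in> balanced_stochastic. \<forall>i j. 0 \<le> X $ i $ j \<and> X $ i $ j \<le> 1}"

definition objective :: "real^'n^'n \<Rightarrow> real^'m^'n \<Rightarrow> real^'m^'n \<Rightarrow> real" where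
  "objective A G X = 1/2 * (A \<bullet> (X ** transpose X)) + G \<bullet> X"

definition penalized_objective ::
    "real^'n^'n \<Rightarrow> real^'m^'n \<Rightarrow> real \<Rightarrow> real^'m^'n \<Rightarrow> real" where
  "penalized_objective A G \<eta> X =
     objective A G X + \<eta> * (\<Sum>i\<in>UNIV. \<Sum>j\<in>UNIV. \<bar>X $ i $ j\<bar> powr (1/2))"

definition global_minimizer :: "('a \<Rightarrow> real) \<Rightarrow> 'a set \<Rightarrow> 'a \<Rightarrow> bool" where
  "global_minimizer f S x \<longleftrightarrow> x \<in> S \<and> (\<forall>y\<in>S. f x \<le> f y)"

definition local_minimizer :: "('a::topological_space \<Rightarrow> real) \<Rightarrow> 'a set \<Rightarrow> 'a \<Rightarrow> bool" where
  "local_minimizer f S x \<longleftrightarrow> (\<exists>U. open U \<and> x \<in> U \<and> global_minimizer f (S \<inter> U) x)"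

end

theory Submission
  imports Defs
begin

text \<open>
  Along a direction \<open>D\<close> supported on fractional entries of \<open>X\<close>, the quadratic term has curvature at
  most \<open>\<parallel>A\<parallel>\<^sub>\<infinity> \<parallel>D\<parallel>\<^sup>2\<close>, while the penalty has curvature at most \<open>- \<eta>/4 \<parallel>D\<parallel>\<^sup>2\<close>
  because \<open>X\<^sub>i\<^sub>j \<le> 1\<close>. So for \<open>\<eta> > 4 \<parallel>A\<parallel>\<^sub>\<infinity>\<close> no non-binary point is a local minimizer, provided a
  nonzero \<open>D\<close> with zero row and column sums exists. It does: row and column sums are integers, so
  every row or column with a fractional entry has at least two of them, and there are at least as
  many fractional entries as constraints, which are moreover linearly dependent.
  Conversely, binary points are local minimizers of the penalized problem because the square root
  has infinite slope at \<open>0\<close>, which dominates the linear part of the convex quadratic objective.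
  The global statement follows by compactness, as the penalty is constant on binary points.
\<close>

section \<open>Quantitative concavity of the square root\<close>

text \<open>The constant 1/4 is minus the second derivative of the square root at 1. For the roots
  \<open>p\<close>, \<open>q\<close>, \<open>s\<close> of \<open>x + d\<close>,
  \<open>x - d\<close>, \<open>x\<close>, the factorizations 2d = (p - q)(p + q) and (p - q)^2 = (2s
  - p - q)(2s + p + q) give the bound once p + q \<le> 2s \<le> 2 is known.\<close>

lemma sqrt_midpoint_gap:
  fixes x d :: real
  assumes "0 < x" "x \<le> 1" "\<bar>d\<bar> \<le> x"
  shows "sqrt (x + d) + sqrt (x - d) \<le> 2 * sqrt x - d\<^sup>2 / 4"
proof -
  define s where "s = sqrt x"
  have s: "0 < s" "s \<le> 1" "s\<^sup>2 = x"
    using assms by (auto simp: s_def)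
  define p where "p = sqrt (x + d)"
  define q where "q = sqrt (x - d)"
  have p: "0 \<le> p" "p\<^sup>2 = x + d" and q: "0 \<le> q" "q\<^sup>2 = x - d"
    using assms by (auto simp: p_def q_def)
  have ps: "p + q \<le> 2 * s"
  proof (rule power2_le_imp_le)
    have "0 \<le> (p - q)\<^sup>2" by simp
    then show "(p + q)\<^sup>2 \<le> (2 * s)\<^sup>2"
      using p q s by (simp add: power2_eq_square algebra_simps)
  qed (use s in simp)
  have "2 * d = (p - q) * (p + q)"
    using p(2) q(2) by (simp add: power2_eq_square algebra_simps)
  then have "4 * d\<^sup>2 = (p - q)\<^sup>2 * (p + q)\<^sup>2"
    by (metis (no_types, lifting) four_x_squared power_mult_distrib)
  also have "\<dots> \<le> (p - q)\<^sup>2 * (2 * s)\<^sup>2"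
    using ps p q by (intro mult_left_mono power_mono) auto
  also have "\<dots> \<le> (p - q)\<^sup>2 * 4"
    using s by (intro mult_left_mono) (auto simp: power_le_one)
  finally have d: "d\<^sup>2 \<le> (p - q)\<^sup>2" by simp
  have "(p - q)\<^sup>2 = (2 * s)\<^sup>2 - (p + q)\<^sup>2"
    using p(2) q(2) s(3) by (simp add: power2_eq_square algebra_simps)
  also have "\<dots> = (2 * s - (p + q)) * (2 * s + (p + q))"
    by (simp add: power2_eq_square algebra_simps)
  also have "\<dots> \<le> (2 * s - (p + q)) * 4"
    using ps s by (intro mult_left_mono) auto
  finally show ?thesis
    using d unfolding s_def p_def q_def by simp
qed

section \<open>Quadratic form and expansion of the objective\<close>

lemma inner_mult_transpose_left:
  fixes A :: "real^'n^'n" and X Y :: "real^'m^'n"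
  shows "A \<bullet> (X ** transpose Y) = (A ** Y) \<bullet> X"
proof -
  have "A \<bullet> (X ** transpose Y) = (\<Sum>i\<in>UNIV. \<Sum>k\<in>UNIV. \<Sum>j\<in>UNIV. A$i$k * (X$i$j * Y$k$j))"
    by (simp add: inner_vec_def matrix_matrix_mult_def transpose_def sum_distrib_left)
  also have "\<dots> = (\<Sum>i\<in>UNIV. \<Sum>j\<in>UNIV. \<Sum>k\<in>UNIV. A$i$k * (X$i$j * Y$k$j))"
    by (intro sum.cong refl sum.swap)
  also have "\<dots> = (A ** Y) \<bullet> X"
    by (simp add: inner_vec_def matrix_matrix_mult_def sum_distrib_left sum_distrib_right mult_ac)
  finally show ?thesis .
qed

text \<open>The form splits into one quadratic form of \<open>A\<close> per column of
  \<open>X\<close>, which carries vector bounds over to matrices.\<close>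

lemma inner_mult_transpose_columns:
  fixes A :: "real^'n^'n" and X :: "real^'m^'n"
  shows "A \<bullet> (X ** transpose X) = (\<Sum>j\<in>UNIV. column j X \<bullet> (A *v column j X))"
  unfolding inner_mult_transpose_left
  by (simp add: inner_vec_def matrix_matrix_mult_def matrix_vector_mult_def column_def mult_ac)
     (rule sum.swap)

lemma inner_mult_transpose_right:
  fixes A :: "real^'n^'n" and X Y :: "real^'m^'n"
  assumes "transpose A = A"
  shows "A \<bullet> (X ** transpose Y) = (A ** X) \<bullet> Y"
proof -
  \<comment> \<open>The Frobenius product is unchanged when both arguments are transposed.\<close>
  have "(transpose A) \<bullet> transpose (X ** transpose Y) = A \<bullet> (X ** transpose Y)"
    by (simp add: inner_vec_def transpose_def) (rule sum.swap)
  then show ?thesis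
    using assms inner_mult_transpose_left[of A Y X] by (simp add: matrix_transpose_mul)
qed

text \<open>Exact second-order Taylor expansion: \<open>A ** X + G\<close> is the gradient at
  \<open>X\<close>, symmetry of \<open>A\<close> merging the two mixed terms.\<close>

lemma objective_add:
  fixes A :: "real^'n^'n" and G X D :: "real^'m^'n"
  assumes "transpose A = A"
  shows "objective A G (X + D) =
    objective A G X + (A ** X + G) \<bullet> D + 1/2 * (A \<bullet> (D ** transpose D))"
proof -
  have "A \<bullet> ((X + D) ** transpose (X + D)) = (A ** X) \<bullet> X + (A ** X) \<bullet> D + (A ** D) \<bullet> X + (A ** D) \<bullet> D"
    by (simp add: inner_mult_transpose_left matrix_add_ldistrib inner_add_left inner_add_right)
  moreover have "(A ** D) \<bullet> X = (A ** X) \<bullet> D"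
    using inner_mult_transpose_right[OF assms, of X D] inner_mult_transpose_left[of A X D] by simp
  ultimately show ?thesis
    unfolding objective_def
    by (simp add: inner_mult_transpose_left inner_add_left inner_add_right field_simps)
qed

lemma inner_mult_transpose_nonneg:
  fixes A :: "real^'n^'n" and D :: "real^'m^'n"
  assumes "symmetric_psd A"
  shows "0 \<le> A \<bullet> (D ** transpose D)"
  using assms unfolding inner_mult_transpose_columns symmetric_psd_def by (intro sum_nonneg) auto

lemma row_sum_le_matrix_infnorm:
  "(\<Sum>j\<in>UNIV. \<bar>A $ i $ j\<bar>) \<le> matrix_infnorm (A :: real^'n^'n)"
  unfolding matrix_infnorm_eq_Max_row_sum by (rule Max_ge) auto

lemma matrix_infnorm_nonneg: "0 \<le> matrix_infnorm (A :: real^'n^'n)"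
  by (rule order_trans[OF _ row_sum_le_matrix_infnorm]) (simp add: sum_nonneg)

text \<open>Each product x_i x_k is at most (x_i^2 + x_k^2)/2 in absolute value. By symmetry of
  \<open>A\<close> both halves of the resulting double sum agree, and together they weight x_i^2 by
  the absolute sum of row i.\<close>

lemma quadratic_form_le_infnorm:
  fixes A :: "real^'n^'n"
  assumes "transpose A = A"
  shows "x \<bullet> (A *v x) \<le> matrix_infnorm A * (x \<bullet> x)"
proof -
  have sym: "A$i$k = A$k$i" for i k
    using assms by (metis transpose_def vec_lambda_beta)
  have "x \<bullet> (A *v x) = (\<Sum>i\<in>UNIV. \<Sum>k\<in>UNIV. A$i$k * (x$i * x$k))"
    by (simp add: inner_vec_def matrix_vector_mult_def sum_distrib_left mult_ac)
  also have "\<dots> \<le> (\<Sum>i\<in>UNIV. \<Sum>k\<in>UNIV. \<bar>A$i$k\<bar> * (x$i)\<^sup>2 / 2 + \<bar>A$i$k\<bar> * (x$k)\<^sup>2 / 2)"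
  proof (intro sum_mono)
    fix i k
    have "\<bar>x$i * x$k\<bar> \<le> ((x$i)\<^sup>2 + (x$k)\<^sup>2) / 2"
      using sum_squares_bound[of "\<bar>x$i\<bar>" "\<bar>x$k\<bar>"] by (simp add: abs_mult)
    then have "\<bar>A$i$k\<bar> * \<bar>x$i * x$k\<bar> \<le> \<bar>A$i$k\<bar> * (((x$i)\<^sup>2 + (x$k)\<^sup>2) / 2)"
      by (intro mult_left_mono) auto
    then show "A$i$k * (x$i * x$k) \<le> \<bar>A$i$k\<bar> * (x$i)\<^sup>2 / 2 + \<bar>A$i$k\<bar> * (x$k)\<^sup>2 / 2"
      using abs_ge_self[of "A$i$k * (x$i * x$k)"] by (simp add: abs_mult field_simps)
  qed
  also have "\<dots> = (\<Sum>i\<in>UNIV. \<Sum>k\<in>UNIV. \<bar>A$i$k\<bar> * (x$i)\<^sup>2 / 2) +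
      (\<Sum>i\<in>UNIV. \<Sum>k\<in>UNIV. \<bar>A$i$k\<bar> * (x$k)\<^sup>2 / 2)"
    by (simp add: sum.distrib)
  also have "(\<Sum>i\<in>UNIV. \<Sum>k\<in>UNIV. \<bar>A$i$k\<bar> * (x$k)\<^sup>2 / 2) =
      (\<Sum>i\<in>UNIV. \<Sum>k\<in>UNIV. \<bar>A$i$k\<bar> * (x$i)\<^sup>2 / 2)"
    by (subst sum.swap) (simp add: sym)
  also have "(\<Sum>i\<in>UNIV. \<Sum>k\<in>UNIV. \<bar>A$i$k\<bar> * (x$i)\<^sup>2 / 2) + \<dots> =
      (\<Sum>i\<in>UNIV. (\<Sum>k\<in>UNIV. \<bar>A$i$k\<bar>) * (x$i)\<^sup>2)"
    by (simp flip: sum.distrib add: sum_distrib_right)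
  also have "\<dots> \<le> (\<Sum>i\<in>UNIV. matrix_infnorm A * (x$i)\<^sup>2)"
    by (intro sum_mono mult_right_mono row_sum_le_matrix_infnorm) auto
  also have "\<dots> = matrix_infnorm A * (x \<bullet> x)"
    by (simp add: inner_vec_def sum_distrib_left power2_eq_square)
  finally show ?thesis .
qed

lemma inner_mult_transpose_le_infnorm:
  fixes A :: "real^'n^'n" and D :: "real^'m^'n"
  assumes "transpose A = A"
  shows "A \<bullet> (D ** transpose D) \<le> matrix_infnorm A * (D \<bullet> D)"
proof -
  have "A \<bullet> (D ** transpose D) \<le> (\<Sum>j\<in>UNIV. matrix_infnorm A * (column j D \<bullet> column j D))"
    unfolding inner_mult_transpose_columns by (intro sum_mono quadratic_form_le_infnorm assms)
  also have "(\<Sum>j\<in>UNIV. column j D \<bullet> column j D) = D \<bullet> D"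
    by (simp add: inner_vec_def column_def) (rule sum.swap)
  then have "(\<Sum>j\<in>UNIV. matrix_infnorm A * (column j D \<bullet> column j D)) = matrix_infnorm A * (D \<bullet> D)"
    by (simp flip: sum_distrib_left)
  finally show ?thesis .
qed

section \<open>Feasible directions at points with fractional entries\<close>

lemma balanced_stochastic_iff:
  "(X :: real^'m^'n) \<in> balanced_stochastic \<longleftrightarrow>
    (\<forall>j. (\<Sum>i\<in>UNIV. X$i$j) = real CARD('n) / real CARD('m)) \<and> (\<forall>i. (\<Sum>j\<in>UNIV. X$i$j) = 1)"
  by (simp add: balanced_stochastic_def vec_eq_iff vector_matrix_mult_def matrix_vector_mult_def)

lemma powr_half_eq_sqrt: "\<bar>x\<bar> powr (1/2) = sqrt \<bar>x\<bar>"
  by (simp add: powr_half_sqrt)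

text \<open>Otherwise \<open>f i\<close> would be a difference of integers. This excludes rows and
  columns with a single fractional entry.\<close>

lemma nonint_summand_not_unique:
  fixes f :: "'a::finite \<Rightarrow> real"
  assumes "sum f UNIV \<in> \<int>" "f i \<notin> \<int>"
  shows "\<exists>k. k \<noteq> i \<and> f k \<notin> \<int>"
proof (rule ccontr)
  assume "\<not> ?thesis"
  then have "sum f (UNIV - {i}) \<in> \<int>"
    by (intro Ints_sum) auto
  moreover have "f i = sum f UNIV - sum f (UNIV - {i})"
    by (simp add: sum.remove[of UNIV i])
  ultimately show False
    using assms by (metis Ints_diff)
qed

text \<open>Every nonempty fibre of \<open>fst\<close> on \<open>S\<close> has at least two
  elements.\<close>

lemma card_fst_image_le:
  assumes "finite S" "\<And>p. p \<in> S \<Longrightarrow> \<exists>q\<in>S. q \<noteq> p \<and> fst q = fst p"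
  shows "2 * card (fst ` S) \<le> card S"
proof -
  have "2 \<le> card {p\<in>S. fst p = i}" if "i \<in> fst ` S" for i
  proof -
    obtain p where p: "p \<in> S" "fst p = i" using \<open>i \<in> fst ` S\<close> by auto
    obtain q where q: "q \<in> S" "q \<noteq> p" "fst q = i" using assms(2)[OF p(1)] p by auto
    have "card {p, q} \<le> card {p\<in>S. fst p = i}"
      using p q assms(1) by (intro card_mono) auto
    then show ?thesis using q by simp
  qed
  then have "(\<Sum>i\<in>fst ` S. 2) \<le> (\<Sum>i\<in>fst ` S. card {p\<in>S. fst p = i})"
    by (intro sum_mono) auto
  also have "\<dots> = card S"
    using assms(1) sum.image_gen[of S "\<lambda>_. 1::nat" fst] by simp
  finally show ?thesis by simp
qed

text \<open>Dimension count by contradiction: if the map \<open>L\<close> to row and column sums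
  were injective on matrices supported in \<open>S\<close>, its image would have dimension
  \<open>card S\<close>, enough to fill the space \<open>W\<close> of vectors supported on the rows
  and columns that meet \<open>S\<close>. Yet the row sums and the column sums of a matrix have the
  same total.\<close>

lemma exists_zero_sum_matrix:
  fixes S :: "('n::finite \<times> 'm::finite) set"
  assumes "S \<noteq> {}"
    and row: "\<And>p. p \<in> S \<Longrightarrow> \<exists>q\<in>S. q \<noteq> p \<and> fst q = fst p"
    and col: "\<And>p. p \<in> S \<Longrightarrow> \<exists>q\<in>S. q \<noteq> p \<and> snd q = snd p"
  shows "\<exists>D :: real^'m^'n. D \<noteq> 0 \<and> (\<forall>i j. (i, j) \<notin> S \<longrightarrow> D$i$j = 0) \<and>
    (\<forall>i. (\<Sum>j\<in>UNIV. D$i$j) = 0) \<and> (\<forall>j. (\<Sum>i\<in>UNIV. D$i$j) = 0)"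
proof (rule ccontr)
  assume no: "\<not> ?thesis"
  define L :: "real^('n \<times> 'm) \<Rightarrow> real^('n + 'm)" where
    "L x = (\<chi> s. case s of Inl i \<Rightarrow> \<Sum>j\<in>UNIV. x$(i, j) | Inr j \<Rightarrow> \<Sum>i\<in>UNIV. x$(i, j))" for x
  define T where "T = Inl ` fst ` S \<union> Inr ` snd ` S"
  define V where "V = {x :: real^('n \<times> 'm). \<forall>p. p \<notin> S \<longrightarrow> x$p = 0}"
  define W where "W = {y :: real^('n + 'm). \<forall>s. s \<notin> T \<longrightarrow> y$s = 0}"
  have lin: "Vector_Spaces.linear (*s) (*s) L"
    by unfold_locales
      (auto simp: L_def vec_eq_iff sum.distrib sum_distrib_left algebra_simps split: sum.split)
  have ker: "x = 0" if "x \<in> V" "L x = 0" for x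
  proof -
    define D :: "real^'m^'n" where "D = (\<chi> i j. x$(i, j))"
    have "(\<Sum>j\<in>UNIV. D$i$j) = 0" for i
      using arg_cong[OF that(2), of "\<lambda>y. y $ Inl i"] by (simp add: L_def D_def)
    moreover have "(\<Sum>i\<in>UNIV. D$i$j) = 0" for j
      using arg_cong[OF that(2), of "\<lambda>y. y $ Inr j"] by (simp add: L_def D_def)
    moreover have "\<forall>i j. (i, j) \<notin> S \<longrightarrow> D$i$j = 0"
      using that(1) by (simp add: D_def V_def)
    ultimately have "D = 0" using no by blast
    then show ?thesis by (auto simp: D_def vec_eq_iff)
  qed
  have subV: "vec.subspace V" and subW: "vec.subspace W"
    unfolding V_def W_def by (auto simp: vec.subspace_def)
  have inj: "inj_on L (vec.span V)"
    unfolding vec.span_eq_iff[THEN iffD2, OF subV]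
    using ker vec.linear_inj_on_iff_eq_0[OF lin subV] by blast
  \<comment> \<open>The rows and the columns meeting \<open>S\<close> each number at most half of
    \<open>card S\<close>, so together they do not exceed it.\<close>
  have "2 * card (fst ` S) \<le> card S"
    by (rule card_fst_image_le) (use row in auto)
  moreover have "2 * card (fst ` prod.swap ` S) \<le> card (prod.swap ` S)"
    by (rule card_fst_image_le) (use col in force)+
  then have "2 * card (snd ` S) \<le> card S"
    by (simp add: image_image card_image)
  moreover have "card T = card (fst ` S) + card (snd ` S)"
    unfolding T_def by (subst card_Un_disjoint) (auto simp: card_image)
  ultimately have "card T \<le> card S" by simp
  also have "card S = vec.dim (L ` V)"
    unfolding vec.dim_image_eq[OF lin inj] unfolding V_def by (rule dim_substandard_cart[symmetric])
  finally have dim: "vec.dim W \<le> vec.dim (L ` V)"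
    by (simp add: W_def dim_substandard_cart)
  have "L ` V \<subseteq> W"
  proof clarify
    fix x assume "x \<in> V"
    then have x: "x$(i, j) = 0" if "(i, j) \<notin> S" for i j
      using that by (simp add: V_def)
    have "L x $ s = 0" if "s \<notin> T" for s
    proof (cases s)
      case (Inl i)
      then have "(i, j) \<notin> S" for j using that by (force simp: T_def)
      then show ?thesis using x Inl by (simp add: L_def)
    next
      case (Inr j)
      then have "(i, j) \<notin> S" for i using that by (force simp: T_def)
      then show ?thesis using x Inr by (simp add: L_def)
    qed
    then show "L x \<in> W" by (simp add: W_def)
  qed
  then have LV: "L ` V = W"
    using dim by (intro vec.subspace_dim_equal vec.linear_subspace_image lin subV subW)
  \<comment> \<open>A unit vector at one row lies in \<open>W\<close> but has row total 1 and column
    total 0, so it is no image under \<open>L\<close>.\<close>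
  obtain i j where "(i, j) \<in> S" using assms(1) by auto
  then have "axis (Inl i) 1 \<in> W"
    by (force simp: W_def T_def axis_def)
  then obtain x where x: "L x = axis (Inl i) 1" using LV by force
  have "(\<Sum>i\<in>UNIV. L x $ Inl i) = (\<Sum>j\<in>UNIV. L x $ Inr j)"
    by (simp add: L_def) (rule sum.swap)
  then show False by (simp add: x axis_def)
qed

lemma matrix_entry_le_norm: "\<bar>(M :: real^'m^'n) $ i $ j\<bar> \<le> norm M"
  by (metis Finite_Cartesian_Product.norm_nth_le order_trans real_norm_def)

text \<open>The direction lives on the entries strictly between 0 and 1, where moves of both signs
  are possible, and is scaled to fit.\<close>

lemma fractional_entry_direction:
  fixes X :: "real^'m^'n"
  assumes dvd: "CARD('m) dvd CARD('n)"
    and X: "X \<in> feasible_relaxed" "X \<notin> feasible_binary"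
    and "0 < \<epsilon>"
  obtains D where "D \<noteq> 0" "norm D < \<epsilon>" "\<And>i j. D$i$j \<noteq> 0 \<Longrightarrow> 0 < X$i$j" "\<And>i j. \<bar>D$i$j\<bar> \<le> X$i$j"
    "X + D \<in> feasible_relaxed" "X - D \<in> feasible_relaxed"
proof -
  have bal: "X \<in> balanced_stochastic" and bd: "0 \<le> X$i$j" "X$i$j \<le> 1" for i j
    using X by (auto simp: feasible_relaxed_def)
  have frac: "X$i$j \<notin> \<int> \<longleftrightarrow> X$i$j \<noteq> 0 \<and> X$i$j \<noteq> 1" for i j
    using bd[of i j] by (auto elim!: Ints_cases)
  define S where "S = {p. X $ fst p $ snd p \<notin> \<int>}"
  have "S \<noteq> {}"
    using X bal frac by (auto simp: S_def feasible_binary_def)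
  moreover have "\<exists>q\<in>S. q \<noteq> p \<and> fst q = fst p" if "p \<in> S" for p
  proof -
    have "\<exists>k. k \<noteq> snd p \<and> X $ fst p $ k \<notin> \<int>"
      using that bal by (intro nonint_summand_not_unique) (auto simp: S_def balanced_stochastic_iff)
    then obtain k where "k \<noteq> snd p" "X $ fst p $ k \<notin> \<int>" by blast
    then show ?thesis by (intro bexI[of _ "(fst p, k)"]) (auto simp: S_def prod_eq_iff)
  qed
  moreover have "\<exists>q\<in>S. q \<noteq> p \<and> snd q = snd p" if "p \<in> S" for p
  proof -
    \<comment> \<open>Divisibility enters here: it makes the prescribed column sum an
      integer.\<close>
    have "real CARD('n) / real CARD('m) \<in> \<int>"
      using dvd by (metis Ints_of_nat real_of_nat_div)
    then have "\<exists>k. k \<noteq> fst p \<and> X $ k $ snd p \<notin> \<int>"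
      using that bal
      by (intro nonint_summand_not_unique[where f = "\<lambda>k. X $ k $ snd p"])
        (auto simp: S_def balanced_stochastic_iff)
    then obtain k where "k \<noteq> fst p" "X $ k $ snd p \<notin> \<int>" by blast
    then show ?thesis by (intro bexI[of _ "(k, snd p)"]) (auto simp: S_def prod_eq_iff)
  qed
  ultimately obtain D :: "real^'m^'n" where D: "D \<noteq> 0" "\<And>i j. (i, j) \<notin> S \<Longrightarrow> D$i$j = 0"
    "\<And>i. (\<Sum>j\<in>UNIV. D$i$j) = 0" "\<And>j. (\<Sum>i\<in>UNIV. D$i$j) = 0"
    using exists_zero_sum_matrix[of S] by blast
  \<comment> \<open>\<open>m\<close> is the least distance of a fractional entry to 0 or 1.\<close>
  define m where "m = Min ((\<lambda>(i, j). min (X$i$j) (1 - X$i$j)) ` S)"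
  have m: "0 < m"
    unfolding m_def using \<open>S \<noteq> {}\<close> bd frac
    by (subst Min_gr_iff) (auto simp: S_def order.strict_iff_order)
  \<comment> \<open>\<open>e\<close> becomes the norm of the direction and hence bounds each of its
    entries; the half keeps it strictly below \<epsilon>.\<close>
  define e where "e = min m (\<epsilon> / 2)"
  have e: "0 < e" "e < \<epsilon>"
    using m \<open>0 < \<epsilon>\<close> by (auto simp: e_def)
  have e_le: "e \<le> X$i$j" "e \<le> 1 - X$i$j" if "(i, j) \<in> S" for i j
  proof -
    have "m \<le> (\<lambda>(i, j). min (X$i$j) (1 - X$i$j)) (i, j)"
      unfolding m_def using that by (intro Min_le imageI) auto
    then show "e \<le> X$i$j" "e \<le> 1 - X$i$j" by (auto simp: e_def)
  qed
  define c where "c = e / norm D"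
  have c: "c > 0" using e D by (simp add: c_def)
  define E where "E = c *\<^sub>R D"
  have "\<bar>E$i$j\<bar> \<le> e" for i j
  proof -
    have "\<bar>E$i$j\<bar> \<le> norm E" by (rule matrix_entry_le_norm)
    also have "norm E = e" using e D by (simp add: E_def c_def)
    finally show ?thesis .
  qed
  moreover have E0: "E$i$j = 0" if "(i, j) \<notin> S" for i j
    using D that by (simp add: E_def)
  ultimately have E: "\<bar>E$i$j\<bar> \<le> X$i$j" "\<bar>E$i$j\<bar> \<le> 1 - X$i$j" for i j
    using e_le[of i j] bd[of i j] by (cases "(i, j) \<in> S"; force intro: order_trans)+
  have sums: "(\<Sum>j\<in>UNIV. E$i$j) = 0" "(\<Sum>i\<in>UNIV. E$i$j) = 0" for i j
    using D(3,4) by (simp_all add: E_def flip: sum_distrib_left)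
  show thesis
  proof
    show "E \<noteq> 0" using c D by (simp add: E_def)
    show "norm E < \<epsilon>" using e D by (simp add: E_def c_def)
    show "0 < X$i$j" if "E$i$j \<noteq> 0" for i j using that E(1)[of i j] by simp
    show "\<bar>E$i$j\<bar> \<le> X$i$j" for i j by (rule E)
    show "X + E \<in> feasible_relaxed" "X - E \<in> feasible_relaxed"
      using bal E sums
      by (auto simp: feasible_relaxed_def balanced_stochastic_iff sum.distrib sum_subtractf abs_le_iff)
        (smt (verit) E)+
  qed
qed

section \<open>Non-binary points are not local minimizers\<close>

text \<open>The gradient terms for \<open>D\<close> and \<open>- D\<close> cancel.\<close>

lemma objective_midpoint:
  fixes A :: "real^'n^'n" and G X D :: "real^'m^'n"
  assumes "transpose A = A"
  shows "objective A G (X + D) + objective A G (X - D) =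
    2 * objective A G X + A \<bullet> (D ** transpose D)"
proof -
  have "A ** (- D) = - (A ** D)"
    by (simp add: matrix_matrix_mult_def vec_eq_iff sum_negf)
  then have "A \<bullet> (- D ** transpose (- D)) = A \<bullet> (D ** transpose D)"
    by (simp add: inner_mult_transpose_left)
  then show ?thesis
    using objective_add[OF assms, of G X D] objective_add[OF assms, of G X "- D"] by simp
qed

text \<open>In the second difference the objective contributes at most
  \<open>matrix_infnorm A * (D \<bullet> D)\<close> and the penalty at most -\<eta>/4 times
  \<open>D \<bullet> D\<close>, by \<open>sqrt_midpoint_gap\<close> at each entry. The threshold on
  \<eta> makes the sum negative.\<close>

lemma penalized_objective_midpoint_less:
  fixes A :: "real^'n^'n" and G X D :: "real^'m^'n"
  assumes "transpose A = A" and \<eta>: "\<eta> > 4 * matrix_infnorm A"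
    and X: "X \<in> feasible_relaxed"
    and D: "D \<noteq> 0" "\<And>i j. D$i$j \<noteq> 0 \<Longrightarrow> 0 < X$i$j" "\<And>i j. \<bar>D$i$j\<bar> \<le> X$i$j"
  shows "penalized_objective A G \<eta> (X + D) + penalized_objective A G \<eta> (X - D) <
    2 * penalized_objective A G \<eta> X"
proof -
  define p where "p Y = (\<Sum>i\<in>UNIV. \<Sum>j\<in>UNIV. \<bar>Y $ i $ j\<bar> powr (1/2))" for Y :: "real^'m^'n"
  have pen: "penalized_objective A G \<eta> Y = objective A G Y + \<eta> * p Y" for Y
    by (simp add: penalized_objective_def p_def)
  have "\<eta> > 0" using \<eta> matrix_infnorm_nonneg[of A] by linarith
  have "p (X + D) + p (X - D) =
      (\<Sum>i\<in>UNIV. \<Sum>j\<in>UNIV. sqrt \<bar>X$i$j + D$i$j\<bar> + sqrt \<bar>X$i$j - D$i$j\<bar>)"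
    by (simp add: p_def powr_half_eq_sqrt sum.distrib)
  also have "\<dots> \<le> (\<Sum>i\<in>UNIV. \<Sum>j\<in>UNIV. 2 * sqrt \<bar>X$i$j\<bar> - (D$i$j)\<^sup>2 / 4)"
  proof (intro sum_mono)
    fix i j
    show "sqrt \<bar>X$i$j + D$i$j\<bar> + sqrt \<bar>X$i$j - D$i$j\<bar> \<le> 2 * sqrt \<bar>X$i$j\<bar> - (D$i$j)\<^sup>2 / 4"
    proof (cases "D$i$j = 0")
      case False
      have "X$i$j \<le> 1" using X by (simp add: feasible_relaxed_def)
      moreover have "\<bar>X$i$j + D$i$j\<bar> = X$i$j + D$i$j" "\<bar>X$i$j - D$i$j\<bar> = X$i$j - D$i$j"
        using D(3)[of i j] by auto
      ultimately show ?thesis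
        using sqrt_midpoint_gap[of "X$i$j" "D$i$j"] D(2)[OF False] D(3)[of i j] by simp
    qed simp
  qed
  also have "\<dots> = 2 * p X - (D \<bullet> D) / 4"
    by (simp add: p_def powr_half_eq_sqrt sum_subtractf inner_vec_def power2_eq_square
        flip: sum_distrib_left sum_divide_distrib)
  finally have "\<eta> * (p (X + D) + p (X - D)) \<le> \<eta> * (2 * p X - (D \<bullet> D) / 4)"
    using \<open>\<eta> > 0\<close> by simp
  moreover have "A \<bullet> (D ** transpose D) \<le> matrix_infnorm A * (D \<bullet> D)"
    using assms(1) by (rule inner_mult_transpose_le_infnorm)
  moreover have "4 * matrix_infnorm A * (D \<bullet> D) < \<eta> * (D \<bullet> D)"
    using \<eta> D(1) by (intro mult_strict_right_mono) auto
  ultimately show ?thesis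
    using objective_midpoint[OF assms(1), of G X D] unfolding pen by (simp add: algebra_simps)
qed

lemma global_minimizer_imp_local: "global_minimizer f S x \<Longrightarrow> local_minimizer f S x"
  unfolding local_minimizer_def by (intro exI[of _ UNIV]) simp

text \<open>The values at \<open>X + D\<close> and \<open>X - D\<close> average below the value at
  \<open>X\<close>, so one of these two nearby feasible points is better.\<close>

lemma penalized_local_minimizer_binary:
  fixes A :: "real^'n^'n" and G X :: "real^'m^'n"
  assumes "CARD('m) dvd CARD('n)" "transpose A = A" "\<eta> > 4 * matrix_infnorm A"
    and loc: "local_minimizer (penalized_objective A G \<eta>) feasible_relaxed X"
  shows "X \<in> feasible_binary"
proof (rule ccontr)
  assume "X \<notin> feasible_binary"
  obtain U where U: "open U" "X \<in> U" "X \<in> feasible_relaxed"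
    and min: "\<And>Y. Y \<in> feasible_relaxed \<Longrightarrow> Y \<in> U \<Longrightarrow>
      penalized_objective A G \<eta> X \<le> penalized_objective A G \<eta> Y"
    using loc by (auto simp: local_minimizer_def global_minimizer_def)
  obtain \<epsilon> where \<epsilon>: "\<epsilon> > 0" "ball X \<epsilon> \<subseteq> U"
    using U by (meson open_contains_ball)
  obtain D where D: "D \<noteq> 0" "norm D < \<epsilon>" "\<And>i j. D$i$j \<noteq> 0 \<Longrightarrow> 0 < X$i$j"
    "\<And>i j. \<bar>D$i$j\<bar> \<le> X$i$j" "X + D \<in> feasible_relaxed" "X - D \<in> feasible_relaxed"
    using fractional_entry_direction[OF assms(1) U(3) \<open>X \<notin> feasible_binary\<close> \<epsilon>(1)] by metis
  have "X + D \<in> U" "X - D \<in> U"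
    using \<epsilon>(2) D(2) by (auto simp: subset_iff dist_norm)
  then show False
    using min[OF D(5)] min[OF D(6)] U(3)
      penalized_objective_midpoint_less[OF assms(2,3) U(3) D(1,3,4), where G = G] by simp
qed

section \<open>Binary points as local minimizers\<close>

lemma binary_isolated:
  fixes X Y :: "real^'m^'n"
  assumes "X \<in> feasible_binary" "Y \<in> feasible_binary" "dist X Y < 1"
  shows "X = Y"
proof -
  have "X$i$j = Y$i$j" for i j
  proof -
    have "\<bar>X$i$j - Y$i$j\<bar> < 1"
      using matrix_entry_le_norm[of "X - Y" i j] assms(3) by (simp add: dist_norm)
    moreover have "X$i$j \<in> {0, 1}" "Y$i$j \<in> {0, 1}"
      using assms by (auto simp: feasible_binary_def)
    ultimately show ?thesis by auto
  qed
  then show ?thesis by (simp add: vec_eq_iff)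
qed

text \<open>Distinct binary feasible points are at distance at least 1, so the unit ball contains no
  competitor, whatever \<open>f\<close> is.\<close>

lemma binary_local_minimizer:
  fixes X :: "real^'m^'n"
  assumes "X \<in> feasible_binary"
  shows "local_minimizer f feasible_binary X"
  unfolding local_minimizer_def
proof (intro exI conjI)
  show "global_minimizer f (feasible_binary \<inter> ball X 1) X"
    using assms binary_isolated by (force simp: global_minimizer_def)
qed auto

lemma feasible_binary_subset_relaxed: "feasible_binary \<subseteq> feasible_relaxed"
proof
  fix X :: "real^'a^'b" assume X: "X \<in> feasible_binary"
  then have "X$i$j = 0 \<or> X$i$j = 1" for i j by (simp add: feasible_binary_def)
  then have "0 \<le> X$i$j \<and> X$i$j \<le> 1" for i j by (metis order_refl zero_le_one)
  then show "X \<in> feasible_relaxed" using X by (simp add: feasible_binary_def feasible_relaxed_def)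
qed

text \<open>The entries 0 and 1 equal their square roots, so the penalty sum is the sum of all row
  sums.\<close>

lemma penalized_objective_binary:
  fixes X G :: "real^'m^'n"
  assumes "X \<in> feasible_binary"
  shows "penalized_objective A G \<eta> X = objective A G X + \<eta> * real CARD('n)"
proof -
  have "\<bar>X$i$j\<bar> powr (1/2) = X$i$j" for i j
    using assms by (auto simp: feasible_binary_def)
      (metis abs_one abs_zero powr_one_eq_one powr_0)
  moreover have "(\<Sum>j\<in>UNIV. X$i$j) = 1" for i
    using assms by (simp add: feasible_binary_def balanced_stochastic_iff)
  ultimately show ?thesis
    by (simp add: penalized_objective_def)
qed

text \<open>Convexity bounds the objective below by its linearization with gradient
  \<open>P\<close>, so it suffices that the penalty rises by at least
  \<open>- (P \<bullet> D)\<close>. Losses at entries 1 of \<open>X\<close> are paid by gains at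
  entries 0, since the rows of \<open>D\<close> sum to zero.\<close>

lemma binary_penalized_local_minimizer:
  fixes A :: "real^'n^'n" and G X :: "real^'m^'n"
  assumes psd: "symmetric_psd A" and "\<eta> > 0" and X: "X \<in> feasible_binary"
  shows "local_minimizer (penalized_objective A G \<eta>) feasible_relaxed X"
proof -
  define P where "P = A ** X + G"
  define M where "M = norm P"
  \<comment> \<open>\<open>K\<close> is chosen so that \<eta> K = 2M + \<eta>, the slope to be
    beaten at entries 0 of \<open>X\<close>. There K y \<le> \<open>sqrt y\<close> holds for 0 \<le>
    y \<le> 1/K^2, whence the radius \<delta>.\<close>
  define K where "K = 2 * M / \<eta> + 1"
  have "K > 0" using \<open>\<eta> > 0\<close> by (auto simp: K_def M_def intro!: add_nonneg_pos)
  have \<eta>K: "\<eta> * K = 2 * M + \<eta>" using \<open>\<eta> > 0\<close> by (simp add: K_def field_simps)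
  define \<delta> where "\<delta> = 1 / K\<^sup>2"
  have "\<delta> > 0" using \<open>K > 0\<close> by (simp add: \<delta>_def)
  have "penalized_objective A G \<eta> X \<le> penalized_objective A G \<eta> Y"
    if Y: "Y \<in> feasible_relaxed" and near: "Y \<in> ball X \<delta>" for Y
  proof -
    define D where "D = Y - X"
    have D_small: "\<bar>D$i$j\<bar> < \<delta>" for i j
      using matrix_entry_le_norm[of D i j] near by (simp add: D_def dist_norm norm_minus_commute)
    have D_sum: "(\<Sum>j\<in>UNIV. D$i$j) = 0" for i
      using X Y by (simp add: D_def feasible_binary_def feasible_relaxed_def
          balanced_stochastic_iff sum_subtractf)
    \<comment> \<open>The linear term \<open>(\<eta> + M) * D$i$j\<close> cancels on every row; its coefficient is chosen so that the
      bound holds both at entries \<open>0\<close> and at entries \<open>1\<close> of \<open>X\<close>.\<close>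
    have entry: "M * \<bar>D$i$j\<bar> + (\<eta> + M) * D$i$j \<le> \<eta> * (sqrt \<bar>Y$i$j\<bar> - sqrt \<bar>X$i$j\<bar>)" for i j
    proof -
      have y: "0 \<le> Y$i$j" "Y$i$j \<le> 1" using Y by (auto simp: feasible_relaxed_def)
      have "X$i$j \<in> {0, 1}" using X by (auto simp: feasible_binary_def)
      then consider "X$i$j = 0" | "X$i$j = 1" by auto
      then show ?thesis
      proof cases
        case 1
        then have D: "D$i$j = Y$i$j" by (simp add: D_def)
        then have "Y$i$j < \<delta>" using D_small[of i j] by simp
        then have "K\<^sup>2 * Y$i$j \<le> 1" using \<open>K > 0\<close> by (simp add: \<delta>_def field_simps)
        then have "(K * Y$i$j)\<^sup>2 \<le> Y$i$j"
          using mult_right_mono[of "K\<^sup>2 * Y$i$j" 1 "Y$i$j"] y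
          by (simp add: power2_eq_square mult_ac)
        then have "K * Y$i$j \<le> sqrt (Y$i$j)" by (rule real_le_rsqrt)
        then have "\<eta> * K * Y$i$j \<le> \<eta> * sqrt (Y$i$j)" using \<open>\<eta> > 0\<close> by simp
        then show ?thesis using y 1 D unfolding \<eta>K by (simp add: algebra_simps)
      next
        case 2
        \<comment> \<open>Here \<open>D$i$j\<close> is nonpositive, so the \<open>M\<close> terms
          cancel and this inequality on [0, 1] suffices.\<close>
        have "Y$i$j \<le> sqrt (Y$i$j)"
          using y by (intro real_le_rsqrt) (simp add: power2_eq_square mult_left_le)
        then have "\<eta> * Y$i$j \<le> \<eta> * sqrt (Y$i$j)" using \<open>\<eta> > 0\<close> by simp
        then show ?thesis using y 2 by (simp add: D_def algebra_simps)
      qed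
    qed
    have "- (P \<bullet> D) \<le> (\<Sum>i\<in>UNIV. \<Sum>j\<in>UNIV. M * \<bar>D$i$j\<bar>)"
      unfolding inner_vec_def sum_negf[symmetric]
    proof (intro sum_mono)
      fix i j
      have "\<bar>P$i$j\<bar> * \<bar>D$i$j\<bar> \<le> M * \<bar>D$i$j\<bar>"
        unfolding M_def by (intro mult_right_mono matrix_entry_le_norm) auto
      then show "- (P$i$j \<bullet> D$i$j) \<le> M * \<bar>D$i$j\<bar>"
        using abs_ge_minus_self[of "P$i$j * D$i$j"] by (simp add: abs_mult)
    qed
    also have "\<dots> = (\<Sum>i\<in>UNIV. \<Sum>j\<in>UNIV. M * \<bar>D$i$j\<bar> + (\<eta> + M) * D$i$j)"
      by (simp add: sum.distrib D_sum flip: sum_distrib_left)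
    also have "\<dots> \<le> (\<Sum>i\<in>UNIV. \<Sum>j\<in>UNIV. \<eta> * (sqrt \<bar>Y$i$j\<bar> - sqrt \<bar>X$i$j\<bar>))"
      by (intro sum_mono entry)
    finally have "- (P \<bullet> D) \<le> \<dots>" .
    moreover have "objective A G Y \<ge> objective A G X + P \<bullet> D"
      using objective_add[of A G X D] inner_mult_transpose_nonneg[OF psd, of D] psd
      by (simp add: P_def D_def symmetric_psd_def)
    ultimately show ?thesis
      by (simp add: penalized_objective_def powr_half_eq_sqrt sum_subtractf
          right_diff_distrib flip: sum_distrib_left)
  qed
  then have "global_minimizer (penalized_objective A G \<eta>) (feasible_relaxed \<inter> ball X \<delta>) X"
    using X feasible_binary_subset_relaxed \<open>\<delta> > 0\<close> by (auto simp: global_minimizer_def)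
  then show ?thesis
    unfolding local_minimizer_def using \<open>\<delta> > 0\<close> by (intro exI[of _ "ball X \<delta>"]) auto
qed

section \<open>Existence of minimizers and comparison of the two problems\<close>

lemma compact_feasible_relaxed: "compact (feasible_relaxed :: (real^'m^'n) set)"
proof -
  have "norm X \<le> real CARD('n) * real CARD('m)" if "X \<in> feasible_relaxed" for X :: "real^'m^'n"
  proof -
    have "norm X \<le> (\<Sum>i\<in>UNIV. norm (X$i))"
      unfolding norm_vec_def by (rule L2_set_le_sum) simp
    also have "\<dots> \<le> (\<Sum>i\<in>UNIV. \<Sum>j\<in>UNIV. \<bar>X$i$j\<bar>)"
      by (intro sum_mono norm_le_l1_cart)
    also have "\<dots> \<le> (\<Sum>i\<in>(UNIV::'n set). \<Sum>j\<in>(UNIV::'m set). 1)"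
      using that by (intro sum_mono) (simp add: feasible_relaxed_def)
    finally show ?thesis by simp
  qed
  then have "bounded (feasible_relaxed :: (real^'m^'n) set)"
    by (meson boundedI)
  moreover have "closed (feasible_relaxed :: (real^'m^'n) set)"
    unfolding feasible_relaxed_def balanced_stochastic_iff
    by (intro closed_Collect_conj closed_Collect_all closed_Collect_le closed_Collect_eq
        continuous_intros)
  ultimately show ?thesis
    by (simp add: compact_eq_bounded_closed)
qed

lemma continuous_on_penalized_objective:
  "continuous_on S (penalized_objective A (G :: real^'m^'n) \<eta>)"
  \<comment> \<open>In square root form the penalty is continuous at zero entries too.\<close>
  unfolding penalized_objective_def objective_def powr_half_eq_sqrt matrix_matrix_mult_def
    transpose_def inner_vec_def
  by (simp, intro continuous_intros) auto

theorem theorem3p3: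
  fixes A :: "real^'n^'n" and G :: "real^'m^'n" and \<eta> :: real
  assumes "CARD('m) dvd CARD('n)"
    and "symmetric_psd A"
    and "\<eta> > 4 * matrix_infnorm A"
  shows "(\<forall>X. local_minimizer (penalized_objective A G \<eta>) feasible_relaxed X \<longrightarrow>
             X \<in> feasible_binary \<and> local_minimizer (objective A G) feasible_binary X) \<and>
         (\<forall>X\<in>feasible_binary. local_minimizer (penalized_objective A G \<eta>) feasible_relaxed X) \<and>
         {X. global_minimizer (objective A G) feasible_binary X} =
           {X. global_minimizer (penalized_objective A G \<eta>) feasible_relaxed X}"
proof -
  let ?f = "penalized_objective A G \<eta>"
  have sym: "transpose A = A" using assms(2) by (simp add: symmetric_psd_def)
  have "\<eta> > 0" using assms(3) matrix_infnorm_nonneg[of A] by linarith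
  note binary = penalized_local_minimizer_binary[OF assms(1) sym assms(3)]
  have "global_minimizer (objective A G) feasible_binary X \<longleftrightarrow>
    global_minimizer ?f feasible_relaxed X" for X
  proof
    assume "global_minimizer (objective A G) feasible_binary X"
    then have X: "X \<in> feasible_binary"
      and min: "\<And>Y. Y \<in> feasible_binary \<Longrightarrow> objective A G X \<le> objective A G Y"
      by (auto simp: global_minimizer_def)
    have Xr: "X \<in> feasible_relaxed" using X feasible_binary_subset_relaxed by blast
    \<comment> \<open>Compactness supplies a relaxed minimizer \<open>Z\<close>, which is binary by
      the local result. The penalty agrees on \<open>X\<close> and \<open>Z\<close>, so optimality
      of \<open>X\<close> among binary points carries over to the relaxed problem.\<close>
    obtain Z where Z: "Z \<in> feasible_relaxed" "\<And>Y. Y \<in> feasible_relaxed \<Longrightarrow> ?f Z \<le> ?f Y"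
      using continuous_attains_inf[OF compact_feasible_relaxed _ continuous_on_penalized_objective] Xr
      by (metis empty_iff)
    have "Z \<in> feasible_binary"
      by (rule binary[where G = G, OF global_minimizer_imp_local]) (use Z in \<open>simp add: global_minimizer_def\<close>)
    then have "?f X \<le> ?f Z"
      using min X by (simp add: penalized_objective_binary)
    then show "global_minimizer ?f feasible_relaxed X"
      using Xr Z(2) by (force simp: global_minimizer_def)
  next
    assume gl: "global_minimizer ?f feasible_relaxed X"
    have X: "X \<in> feasible_binary"
      by (rule binary[OF global_minimizer_imp_local[OF gl]])
    have "objective A G X \<le> objective A G Y" if "Y \<in> feasible_binary" for Y
    proof -
      have "?f X \<le> ?f Y"
        using gl that feasible_binary_subset_relaxed by (auto simp: global_minimizer_def)
      then show ?thesis using X that by (simp add: penalized_objective_binary)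
    qed
    then show "global_minimizer (objective A G) feasible_binary X"
      using X by (simp add: global_minimizer_def)
  qed
  then show ?thesis
    using binary binary_local_minimizer binary_penalized_local_minimizer[OF assms(2) \<open>\<eta> > 0\<close>]
    by blast
qed

end
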